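(* Let $d\ge 1$. The polynomials $\{T_b : b\in B_2(2,d)\}$ (indexed by the bracelets $b \in B_2(2,d)$) are linearly independent over $\mathbb{C}$.
   Context: Let $A_0=\begin{pmatrix} a_1 & a_2 \\ a_3 & a_4\end{pmatrix}$ and $A_1=\begin{pmatrix} b_1 & b_2 \\ b_3 & b_4\end{pmatrix}$ be generic $2\times 2$ matrices whose entries are the eight variables of the polynomial ring $\mathbb{C}[a_1,\dots,a_4,b_1,\dots,b_4]$. For a binary word $i_1\cdots i_d$ with $i_j\in\{0,1\}$, put $T_{i_1\cdots i_d}:=\operatorname{Tr}(A_{i_1}\cdots A_{i_d})\in\mathbb{C}[a_1,\dots,b_4]$. A binary bracelet of length $d$ is an equivalence class of words in $\{0,1\}^d$ under the dihedral group generated by cyclic rotation and reversal of words. For $2\times2$ matrices $T_{i_1\cdots i_d}$ is invariant under rotation and reversal of the word, so $T_b$ is well defined for a bracelet $b$. $B_w(2,d)$ denotes the set of binary bracelets of length $d$ of weight $w$, meaning that they contain exactly $w$ letters equal to $1$. *)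

theory Defs
  imports
    "HOL-Analysis.Analysis"
    "HOL-Algebra.Generated_Groups"
    "HOL-Algebra.Group_Action"
    "HOL-Library.Poly_Mapping"
begin

section \<open>The polynomial ring in the eight matrix entries\<close>

datatype entry = a\<^sub>1 | a\<^sub>2 | a\<^sub>3 | a\<^sub>4 | b\<^sub>1 | b\<^sub>2 | b\<^sub>3 | b\<^sub>4

text \<open>
  A monomial is its exponent map; multiplication on the outer \<^type>\<open>poly_mapping\<close> is convolution,
  so this type is the polynomial ring over the complex numbers in the variables \<^typ>\<open>entry\<close>.
\<close>

type_synonym gpoly = "(entry \<Rightarrow>\<^sub>0 nat) \<Rightarrow>\<^sub>0 complex"

definition var :: "entry \<Rightarrow> gpoly" where
  "var x = Poly_Mapping.single (Poly_Mapping.single x 1) 1"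

definition const :: "complex \<Rightarrow> gpoly" where
  "const c = Poly_Mapping.single 0 c"

definition gscale :: "complex \<Rightarrow> gpoly \<Rightarrow> gpoly" where
  "gscale c p = const c * p"

interpretation gpoly: vector_space gscale
  by unfold_locales
    (simp_all add: gscale_def const_def algebra_simps single_add mult_single
      flip: mult.assoc)


section \<open>Traces of words in two generic matrices\<close>

text \<open>Words in the letters 0 and 1 are lists of truth values, with \<^const>\<open>True\<close> for the letter 1.\<close>

type_synonym word = "bool list"

definition generic_matrix :: "bool \<Rightarrow> gpoly^2^2" where
  "generic_matrix i =
     (if i then vector [vector [var b\<^sub>1, var b\<^sub>2], vector [var b\<^sub>3, var b\<^sub>4]]
      else vector [vector [var a\<^sub>1, var a\<^sub>2], vector [var a\<^sub>3, var a\<^sub>4]])"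

definition word_product :: "word \<Rightarrow> gpoly^2^2" where
  "word_product w = foldr (\<lambda>i M. generic_matrix i ** M) w (mat 1)"

definition word_trace :: "word \<Rightarrow> gpoly" where
  "word_trace w = trace (word_product w)"


section \<open>Binary bracelets\<close>

definition words :: "nat \<Rightarrow> word set" where
  "words d = {w. length w = d}"

definition dihedral_group :: "nat \<Rightarrow> (word \<Rightarrow> word) monoid" where
  "dihedral_group d = (BijGroup (words d))
     \<lparr>carrier := generate (BijGroup (words d)) {restrict rotate1 (words d), restrict rev (words d)}\<rparr>"

definition binary_bracelets :: "nat \<Rightarrow> word set set" where
  "binary_bracelets d = orbits (dihedral_group d) (words d) (\<lambda>g. g)"

definition bracelets_of_weight :: "nat \<Rightarrow> nat \<Rightarrow> word set set" where
  "bracelets_of_weight w d = {b \<in> binary_bracelets d. \<forall>u\<in>b. count_list u True = w}"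

text \<open>
  All words of a bracelet have the same trace; \<open>bracelet_trace_eq\<close> below shows that the
  following is this common value.
\<close>

definition bracelet_trace :: "word set \<Rightarrow> gpoly" where
  "bracelet_trace b = the_elem (word_trace ` b)"


subsection \<open>The trace of a bracelet is well defined\<close>

lemma word_product_append: "word_product (u @ v) = word_product u ** word_product v"
  by (induction u) (simp_all add: word_product_def matrix_mul_assoc)

lemma trace_mult_commute:
  fixes M N :: "'a::comm_semiring_1^2^2"
  shows "trace (M ** N) = trace (N ** M)"
  by (simp add: trace_def matrix_matrix_mult_def sum_2 algebra_simps)

lemma word_trace_rotate1: "word_trace (rotate1 w) = word_trace w"
proof (cases w)
  case (Cons x u)
  have "word_product (x # u) = word_product [x] ** word_product u"
    using word_product_append[of "[x]" u] by simp
  then show ?thesis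
    using Cons trace_mult_commute[of "word_product u" "word_product [x]"]
    by (simp add: word_trace_def word_product_append)
qed simp

text \<open>
  By Cayley--Hamilton, every word product is a combination of the identity, \<open>M\<close>, \<open>N\<close> and \<open>M ** N\<close>;
  reversing the word only replaces \<open>M ** N\<close> by \<open>N ** M\<close>.
\<close>

definition comb :: "'a::comm_ring_1^2^2 \<Rightarrow> 'a^2^2 \<Rightarrow> 'a \<Rightarrow> 'a \<Rightarrow> 'a \<Rightarrow> 'a \<Rightarrow> 'a^2^2" where
  "comb M N p q r s = (\<chi> i j. (if i = j then p else 0) + q * M$i$j + r * N$i$j + s * (M ** N)$i$j)"

lemma comb_step_left:
  defines "t \<equiv> \<lambda>M::'a::comm_ring_1^2^2. M$1$1 + M$2$2"
    and "e \<equiv> \<lambda>M::'a::comm_ring_1^2^2. M$1$1 * M$2$2 - M$1$2 * M$2$1"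
  shows "M ** comb M N p q r s = comb M N (- q * e M) (p + q * t M) (- s * e M) (r + s * t M)"
    and "comb N M p r q s ** M = comb N M (- q * e M) (- s * e M) (p + q * t M) (r + s * t M)"
  unfolding t_def e_def comb_def
  by (simp_all add: vec_eq_iff forall_2 matrix_matrix_mult_def sum_2 algebra_simps)

lemma comb_step_right:
  defines "t \<equiv> \<lambda>M::'a::comm_ring_1^2^2. M$1$1 + M$2$2"
    and "e \<equiv> \<lambda>M::'a::comm_ring_1^2^2. M$1$1 * M$2$2 - M$1$2 * M$2$1"
  defines "c \<equiv> \<lambda>M N. t (M ** N) - t M * t N"
  shows "N ** comb M N p q r s =
      comb M N (q * c M N - r * e N - s * t M * e N) (q * t N + s * e N)
        (p + q * t M + r * t N + s * (t M * t N + c M N)) (- q)"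
    and "comb N M p r q s ** N =
      comb N M (q * c M N - r * e N - s * t M * e N)
        (p + q * t M + r * t N + s * (t M * t N + c M N)) (q * t N + s * e N) (- q)"
  unfolding t_def e_def c_def comb_def
  by (simp_all add: vec_eq_iff forall_2 matrix_matrix_mult_def sum_2 algebra_simps)

lemma word_product_rev_comb:
  fixes w :: word
  defines "M \<equiv> generic_matrix False" and "N \<equiv> generic_matrix True"
  shows "\<exists>p q r s. word_product w = comb M N p q r s \<and> word_product (rev w) = comb N M p r q s"
proof (induction w)
  case Nil
  have "mat 1 = comb M N 1 0 0 0" "mat 1 = comb N M 1 0 0 0"
    by (simp_all add: comb_def mat_def vec_eq_iff)
  then show ?case by (simp add: word_product_def) metis
next
  case (Cons x w)
  then obtain p q r s where
    w: "word_product w = comb M N p q r s" "word_product (rev w) = comb N M p r q s"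
    by blast
  have "word_product (x # w) = generic_matrix x ** comb M N p q r s"
    and "word_product (rev (x # w)) = comb N M p r q s ** generic_matrix x"
    using w by (simp_all add: word_product_append) (simp_all add: word_product_def)
  moreover have "generic_matrix x = (if x then N else M)"
    by (simp add: M_def N_def)
  ultimately show ?case
    by (cases x)
      (simp_all only: if_True if_False comb_step_left comb_step_right,
        (intro exI conjI; rule refl)+)
qed

lemma word_trace_rev: "word_trace (rev w) = word_trace w"
proof -
  have "trace (comb N M p r q s) = trace (comb M N p q r s)" for M N p q r s
    by (simp add: comb_def trace_def sum_2 matrix_matrix_mult_def algebra_simps)
  then show ?thesis
    using word_product_rev_comb[of w] by (auto simp: word_trace_def)
qed

lemma restrict_rotate1_rev_Bij:
  "restrict rotate1 (words d) \<in> Bij (words d)" "restrict rev (words d) \<in> Bij (words d)"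
proof -
  have fin: "finite (words d)"
    using finite_lists_length_eq[of "UNIV :: bool set" d] by (simp add: words_def)
  have inj: "inj_on rotate1 (words d)" "inj_on rev (words d)"
    by (rule inj_on_subset[OF inj_rotate1 subset_UNIV]) (rule inj_on_rev)
  have "rotate1 ` words d \<subseteq> words d" "rev ` words d \<subseteq> words d"
    by (auto simp: words_def)
  then have "bij_betw rotate1 (words d) (words d)" "bij_betw rev (words d) (words d)"
    by (simp_all add: bij_betw_def inj endo_inj_surj[OF fin])
  then show "restrict rotate1 (words d) \<in> Bij (words d)" "restrict rev (words d) \<in> Bij (words d)"
    by (simp_all add: Bij_def)
qed

lemma dihedral_group_trace:
  assumes "g \<in> carrier (dihedral_group d)" and "u \<in> words d"
  shows "word_trace (g u) = word_trace u"
proof -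
  let ?B = "BijGroup (words d)"
  let ?H = "{restrict rotate1 (words d), restrict rev (words d)}"
  have gens: "h \<in> Bij (words d) \<and> (\<forall>u\<in>words d. word_trace (h u) = word_trace u)" if "h \<in> ?H" for h
    using that restrict_rotate1_rev_Bij by (auto simp: word_trace_rotate1 word_trace_rev)
  have "g \<in> generate ?B ?H"
    using assms(1) by (simp add: dihedral_group_def)
  then have "g \<in> Bij (words d) \<and> (\<forall>u\<in>words d. word_trace (g u) = word_trace u)"
  proof induction
    case one
    then show ?case using id_Bij[of "words d"] by (simp add: BijGroup_def restrict_def)
  next
    case (incl h)
    then show ?case using gens by blast
  next
    case (inv h)
    have h: "h \<in> Bij (words d)" "\<And>u. u \<in> words d \<Longrightarrow> word_trace (h u) = word_trace u"
      using gens[OF inv] by auto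
    have "word_trace (inv_into (words d) h u) = word_trace u" if "u \<in> words d" for u
    proof -
      have "bij_betw h (words d) (words d)" using h(1) by (simp add: Bij_def)
      then have "inv_into (words d) h u \<in> words d" "h (inv_into (words d) h u) = u"
        using that by (auto simp: bij_betw_def inv_into_into f_inv_into_f)
      then show ?thesis using h(2) by metis
    qed
    then show ?case using h(1) restrict_inv_into_Bij[OF h(1)]
      by (simp add: inv_BijGroup del: restrict_apply) (simp add: restrict_def)
  next
    case (eng h1 h2)
    then have "\<And>u. u \<in> words d \<Longrightarrow> h2 u \<in> words d"
      by (auto simp: Bij_def bij_betw_def)
    then show ?case using eng by (simp add: BijGroup_def compose_Bij compose_eq)
  qed
  then show ?thesis using assms(2) by blast
qed

lemma bracelet_trace_eq:
  assumes "b \<in> binary_bracelets d" and "u \<in> b"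
  shows "bracelet_trace b = word_trace u"
proof -
  obtain v where "v \<in> words d" "b = {g v | g. g \<in> carrier (dihedral_group d)}"
    using assms(1) by (auto simp: binary_bracelets_def orbits_def orbit_def)
  then have "word_trace x = word_trace v" if "x \<in> b" for x
    using that dihedral_group_trace by auto
  then have "word_trace ` b = {word_trace u}"
    using assms(2) by (auto intro!: image_eqI)
  then show ?thesis by (simp add: bracelet_trace_def)
qed

end

theory Submission
  imports Defs
begin

text \<open>
  A bracelet of weight 2 contains a word \<open>1 0\<^sup>m 1 0\<^sup>n\<close> with \<open>m \<le> n\<close>, whose trace is that of
  \<open>A\<^sub>1 A\<^sub>0\<^sup>m A\<^sub>1 A\<^sub>0\<^sup>n\<close>. Modulo the ideal generated by the off-diagonal entries \<open>a\<^sub>2, a\<^sub>3\<close> the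
  matrix \<open>A\<^sub>0\<close> is diagonal and this trace is
  \<open>b\<^sub>1\<^sup>2 a\<^sub>1\<^sup>d\<^sup>-\<^sup>2 + b\<^sub>2 b\<^sub>3 (a\<^sub>1\<^sup>m a\<^sub>4\<^sup>n + a\<^sub>1\<^sup>n a\<^sub>4\<^sup>m) + b\<^sub>4\<^sup>2 a\<^sub>4\<^sup>d\<^sup>-\<^sup>2\<close>. Hence the monomial
  \<open>b\<^sub>2 b\<^sub>3 a\<^sub>1\<^sup>m a\<^sub>4\<^sup>n\<close> with \<open>m \<le> n\<close> occurs in the trace of exactly one bracelet.
\<close>

lemma lookup_gscale: "Poly_Mapping.lookup (gscale c p) k = c * Poly_Mapping.lookup p k"
  by (simp add: gscale_def const_def flip: mult_map_scale_conv_mult)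
    (simp add: map.rep_eq when_def)

text \<open>The coefficients of the \<open>f i\<close> at the \<open>k j\<close> form a diagonal
  matrix with nonzero diagonal, so reading a vanishing combination at \<open>k i\<close> isolates
  the scalar of \<open>f i\<close>.\<close>

lemma inj_on_and_independent_if_separating_monomials:
  fixes f :: "'i \<Rightarrow> gpoly" and k :: "'i \<Rightarrow> entry \<Rightarrow>\<^sub>0 nat"
  assumes sep: "\<And>i j. i \<in> I \<Longrightarrow> j \<in> I \<Longrightarrow> Poly_Mapping.lookup (f i) (k j) \<noteq> 0 \<longleftrightarrow> i = j"
  shows "inj_on f I \<and> gpoly.independent (f ` I)"
proof
  show inj: "inj_on f I"
    by (rule inj_onI) (metis sep)
  show "gpoly.independent (f ` I)"
    unfolding gpoly.independent_explicit_module
  proof (intro allI impI)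
    fix t u v
    assume t: "finite t" "t \<subseteq> f ` I" and sum0: "(\<Sum>w\<in>t. gscale (u w) w) = 0" and "v \<in> t"
    then obtain i where i: "i \<in> I" "v = f i" by blast
    have "0 = (\<Sum>w\<in>t. u w * Poly_Mapping.lookup w (k i))"
      using arg_cong[OF sum0, of "\<lambda>p. Poly_Mapping.lookup p (k i)"]
      by (simp add: lookup_sum lookup_gscale)
    \<comment> \<open>Any other \<open>w\<close> in \<open>t\<close> is \<open>f j\<close> with
      \<open>j \<noteq> i\<close>, so its coefficient at \<open>k i\<close> vanishes.\<close>
    also have "\<dots> = (\<Sum>w\<in>t. if w = v then u v * Poly_Mapping.lookup v (k i) else 0)"
      using t(2) i sep by (intro sum.cong) auto
    also have "\<dots> = u v * Poly_Mapping.lookup v (k i)"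
      using t(1) \<open>v \<in> t\<close> by simp
    finally show "u v = 0"
      using sep[OF i(1) i(1)] i(2) by simp
  qed
qed


section \<open>Congruence modulo the off-diagonal entries\<close>

text \<open>The ideal generated by \<open>a\<^sub>2\<close> and \<open>a\<^sub>3\<close>. Being a
  monomial ideal, it can be described through the support of a polynomial, which suits the
  comparison of coefficients.\<close>

definition off_diagonal_ideal :: "gpoly set" where
  "off_diagonal_ideal =
     {p. \<forall>m\<in>Poly_Mapping.keys p. Poly_Mapping.lookup m a\<^sub>2 \<noteq> 0 \<or> Poly_Mapping.lookup m a\<^sub>3 \<noteq> 0}"

definition diag_cong :: "gpoly \<Rightarrow> gpoly \<Rightarrow> bool" where
  "diag_cong p q \<longleftrightarrow> p - q \<in> off_diagonal_ideal"

lemma off_diagonal_ideal_add: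
  assumes "p \<in> off_diagonal_ideal" "q \<in> off_diagonal_ideal"
  shows "p + q \<in> off_diagonal_ideal"
  using assms Poly_Mapping.keys_add[of p q] unfolding off_diagonal_ideal_def by blast

lemma off_diagonal_ideal_mult:
  assumes "p \<in> off_diagonal_ideal"
  shows "q * p \<in> off_diagonal_ideal"
proof -
  have "Poly_Mapping.lookup m a\<^sub>2 \<noteq> 0 \<or> Poly_Mapping.lookup m a\<^sub>3 \<noteq> 0"
    if m: "m \<in> Poly_Mapping.keys (q * p)" for m
  proof -
    obtain m1 m2 where "m = m1 + m2" "m2 \<in> Poly_Mapping.keys p"
      using m keys_mult[of q p] by blast
    then show ?thesis
      using assms by (auto simp: off_diagonal_ideal_def lookup_add)
  qed
  then show ?thesis by (simp add: off_diagonal_ideal_def)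
qed

lemma diag_cong_refl: "diag_cong p p"
  by (simp add: diag_cong_def off_diagonal_ideal_def)

lemma diag_cong_add: "diag_cong p p' \<Longrightarrow> diag_cong q q' \<Longrightarrow> diag_cong (p + q) (p' + q')"
  using off_diagonal_ideal_add[of "p - p'" "q - q'"]
  by (simp add: diag_cong_def algebra_simps)

lemma diag_cong_mult:
  assumes "diag_cong p p'" "diag_cong q q'"
  shows "diag_cong (p * q) (p' * q')"
proof -
  have "p * q - p' * q' = q * (p - p') + p' * (q - q')"
    by (simp add: algebra_simps)
  then show ?thesis
    using assms off_diagonal_ideal_add off_diagonal_ideal_mult by (simp add: diag_cong_def)
qed

lemma diag_cong_off_diagonal_var: "diag_cong (var a\<^sub>2) 0" "diag_cong (var a\<^sub>3) 0"
  by (simp_all add: diag_cong_def off_diagonal_ideal_def var_def)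

text \<open>No element of the ideal contains a monomial free of \<open>a\<^sub>2\<close> and
  \<open>a\<^sub>3\<close>. This turns congruences back into statements about coefficients.\<close>

lemma diag_cong_lookup_eq:
  assumes "diag_cong p q" "Poly_Mapping.lookup k a\<^sub>2 = 0" "Poly_Mapping.lookup k a\<^sub>3 = 0"
  shows "Poly_Mapping.lookup p k = Poly_Mapping.lookup q k"
proof -
  have "k \<notin> Poly_Mapping.keys (p - q)"
    using assms by (auto simp: diag_cong_def off_diagonal_ideal_def)
  then show ?thesis by (simp add: in_keys_iff lookup_minus)
qed


section \<open>Traces of words of weight 2\<close>

definition gap_word :: "nat \<Rightarrow> nat \<Rightarrow> word" where
  "gap_word m n = True # replicate m False @ True # replicate n False"

lemma word_product_Cons: "word_product (x # w) = generic_matrix x ** word_product w"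
  by (simp add: word_product_def)

text \<open>Modulo the ideal, the generic matrix of the letter 0 is diagonal with entries
  \<open>a\<^sub>1\<close>, \<open>a\<^sub>4\<close>, and so are its powers.\<close>

lemma word_product_replicate_False_diag_cong:
  defines "P \<equiv> \<lambda>n. word_product (replicate n False)"
  shows "diag_cong (P n $ 1 $ 1) (var a\<^sub>1 ^ n) \<and> diag_cong (P n $ 1 $ 2) 0 \<and>
         diag_cong (P n $ 2 $ 1) 0 \<and> diag_cong (P n $ 2 $ 2) (var a\<^sub>4 ^ n)"
proof (induction n)
  case 0
  show ?case by (simp add: P_def word_product_def mat_def diag_cong_refl)
next
  case (Suc n)
  have P: "P (Suc n) $ 1 $ j = var a\<^sub>1 * P n $ 1 $ j + var a\<^sub>2 * P n $ 2 $ j"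
    "P (Suc n) $ 2 $ j = var a\<^sub>3 * P n $ 1 $ j + var a\<^sub>4 * P n $ 2 $ j" for j
    by (simp_all add: P_def word_product_Cons generic_matrix_def matrix_matrix_mult_def sum_2)
  note intros = diag_cong_add[OF diag_cong_mult diag_cong_mult]
  note vars = diag_cong_off_diagonal_var diag_cong_refl
  show ?case
    \<comment> \<open>One instance for each entry of the product: the summand with an off-diagonal
      variable becomes 0, the other one gains a factor \<open>var a\<^sub>1\<close> or
      \<open>var a\<^sub>4\<close> or stays 0.\<close>
    using
      intros[OF vars(3) _ vars(1), of "P n $ 1 $ 1" "var a\<^sub>1 ^ n" "P n $ 2 $ 1" 0 "var a\<^sub>1"]
      intros[OF vars(3) _ vars(1), of "P n $ 1 $ 2" 0 "P n $ 2 $ 2" "var a\<^sub>4 ^ n" "var a\<^sub>1"]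
      intros[OF vars(2) _ vars(3), of "P n $ 1 $ 1" "var a\<^sub>1 ^ n" "P n $ 2 $ 1" 0 "var a\<^sub>4"]
      intros[OF vars(2) _ vars(3), of "P n $ 1 $ 2" 0 "P n $ 2 $ 2" "var a\<^sub>4 ^ n" "var a\<^sub>4"]
      Suc.IH
    by (simp add: P)
qed

lemma word_trace_gap_word_diag_cong:
  "diag_cong (word_trace (gap_word m n))
     (var b\<^sub>1 ^ 2 * var a\<^sub>1 ^ (m + n) + var b\<^sub>4 ^ 2 * var a\<^sub>4 ^ (m + n)
      + var b\<^sub>2 * var b\<^sub>3 * (var a\<^sub>1 ^ m * var a\<^sub>4 ^ n + var a\<^sub>1 ^ n * var a\<^sub>4 ^ m))"
proof -
  define P where "P = word_product (replicate m False)"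
  define Q where "Q = word_product (replicate n False)"
  \<comment> \<open>The trace as a polynomial in the entries of \<open>P\<close> and
    \<open>Q\<close>. Congruence respects sums and products, so these entries may be replaced by
    their diagonal forms.\<close>
  define f where "f = (\<lambda>p11 p12 p21 p22 q11 q12 q21 q22.
      (var b\<^sub>1 * p11 + var b\<^sub>2 * p21) * (var b\<^sub>1 * q11 + var b\<^sub>2 * q21)
    + (var b\<^sub>1 * p12 + var b\<^sub>2 * p22) * (var b\<^sub>3 * q11 + var b\<^sub>4 * q21)
    + (var b\<^sub>3 * p11 + var b\<^sub>4 * p21) * (var b\<^sub>1 * q12 + var b\<^sub>2 * q22)
    + (var b\<^sub>3 * p12 + var b\<^sub>4 * p22) * (var b\<^sub>3 * q12 + var b\<^sub>4 * q22))"
  have "word_product (gap_word m n) =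
      (generic_matrix True ** P) ** (generic_matrix True ** Q)"
    by (simp add: gap_word_def P_def Q_def word_product_Cons word_product_append matrix_mul_assoc)
  then have "word_trace (gap_word m n) =
      f (P$1$1) (P$1$2) (P$2$1) (P$2$2) (Q$1$1) (Q$1$2) (Q$2$1) (Q$2$2)"
    by (simp add: word_trace_def trace_def matrix_matrix_mult_def sum_2 generic_matrix_def f_def
        algebra_simps)
  moreover have "diag_cong (f (P$1$1) (P$1$2) (P$2$1) (P$2$2) (Q$1$1) (Q$1$2) (Q$2$1) (Q$2$2))
      (f (var a\<^sub>1 ^ m) 0 0 (var a\<^sub>4 ^ m) (var a\<^sub>1 ^ n) 0 0 (var a\<^sub>4 ^ n))"
    using word_product_replicate_False_diag_cong[of m] word_product_replicate_False_diag_cong[of n]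
    unfolding f_def P_def Q_def
    by (intro diag_cong_add diag_cong_mult diag_cong_refl) auto
  ultimately show ?thesis
    by (simp add: f_def algebra_simps power_add power2_eq_square)
qed

definition gap_monomial :: "nat \<Rightarrow> nat \<Rightarrow> entry \<Rightarrow>\<^sub>0 nat" where
  "gap_monomial m n = Poly_Mapping.single b\<^sub>2 1 + Poly_Mapping.single b\<^sub>3 1
     + Poly_Mapping.single a\<^sub>1 m + Poly_Mapping.single a\<^sub>4 n"

lemma gap_monomial_eq_iff: "gap_monomial m n = gap_monomial m' n' \<longleftrightarrow> m = m' \<and> n = n'"
proof
  assume eq: "gap_monomial m n = gap_monomial m' n'"
  show "m = m' \<and> n = n'"
    using arg_cong[OF eq, of "\<lambda>k. Poly_Mapping.lookup k a\<^sub>1"]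
      arg_cong[OF eq, of "\<lambda>k. Poly_Mapping.lookup k a\<^sub>4"]
    by (simp add: gap_monomial_def lookup_add lookup_single)
qed simp

lemma var_power: "var x ^ n = Poly_Mapping.single (Poly_Mapping.single x n) 1"
  by (induction n) (simp_all add: var_def mult_single flip: single_add)

text \<open>The coefficient counts how many of \<open>(m, n)\<close> and \<open>(n, m)\<close> equal
  \<open>(m', n')\<close>. As both pairs are ordered and have the same sum, it is nonzero (1, or 2
  if \<open>m = n\<close>) exactly when \<open>m = m'\<close>.\<close>

lemma lookup_word_trace_gap_word_eq_0_iff:
  assumes "m \<le> n" "m' \<le> n'" "m + n = m' + n'"
  shows "Poly_Mapping.lookup (word_trace (gap_word m n)) (gap_monomial m' n') = 0 \<longleftrightarrow> m \<noteq> m'"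
proof -
  \<comment> \<open>The terms with a squared diagonal entry do not involve \<open>b\<^sub>2\<close>,
    so they contribute nothing.\<close>
  have square: "Poly_Mapping.single b 2 + Poly_Mapping.single a k \<noteq> gap_monomial m' n'"
    if "b = b\<^sub>1 \<and> a = a\<^sub>1 \<or> b = b\<^sub>4 \<and> a = a\<^sub>4" for a b k
  proof
    assume eq: "Poly_Mapping.single b 2 + Poly_Mapping.single a k = gap_monomial m' n'"
    show False
      using arg_cong[OF eq, of "\<lambda>k. Poly_Mapping.lookup k b\<^sub>2"] that
      by (auto simp: gap_monomial_def lookup_add lookup_single)
  qed
  have mixed: "var b\<^sub>2 * var b\<^sub>3 * (var a\<^sub>1 ^ i * var a\<^sub>4 ^ j) =
      Poly_Mapping.single (gap_monomial i j) 1" for i j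
    unfolding var_power by (simp add: var_def mult_single gap_monomial_def add.assoc)
  have "Poly_Mapping.lookup (word_trace (gap_word m n)) (gap_monomial m' n') =
      Poly_Mapping.lookup
        (var b\<^sub>1 ^ 2 * var a\<^sub>1 ^ (m + n) + var b\<^sub>4 ^ 2 * var a\<^sub>4 ^ (m + n)
         + var b\<^sub>2 * var b\<^sub>3 * (var a\<^sub>1 ^ m * var a\<^sub>4 ^ n + var a\<^sub>1 ^ n * var a\<^sub>4 ^ m))
        (gap_monomial m' n')"
    by (rule diag_cong_lookup_eq[OF word_trace_gap_word_diag_cong])
      (simp_all add: gap_monomial_def lookup_add lookup_single)
  also have "\<dots> = (1 when gap_monomial m n = gap_monomial m' n')
      + (1 when gap_monomial n m = gap_monomial m' n')"
    unfolding distrib_left mixed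
    by (simp add: var_power mult_single lookup_add lookup_single square)
  finally show ?thesis
    using assms by (auto simp: gap_monomial_eq_iff when_def)
qed


section \<open>Bracelets of weight 2\<close>

lemma group_action_dihedral_group: "group_action (dihedral_group d) (words d) (\<lambda>g. g)"
proof -
  interpret group "BijGroup (words d)" by (rule group_BijGroup)
  have "subgroup (generate (BijGroup (words d)) {restrict rotate1 (words d), restrict rev (words d)})
      (BijGroup (words d))"
    using restrict_rotate1_rev_Bij by (intro generate_is_subgroup) (simp add: BijGroup_def)
  then show ?thesis
    using canonical_inj_is_hom by (simp add: group_action_def dihedral_group_def id_def)
qed

lemma restrict_rotate1_in_dihedral_group:
  "restrict rotate1 (words d) \<in> carrier (dihedral_group d)"
  by (auto simp: dihedral_group_def intro: generate.incl)

lemma binary_bracelet_rotate: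
  assumes "b \<in> binary_bracelets d" "u \<in> b"
  shows "rotate n u \<in> b"
proof (induction n)
  case 0
  show ?case using assms by simp
next
  case (Suc n)
  interpret group_action "dihedral_group d" "words d" "\<lambda>g. g"
    by (rule group_action_dihedral_group)
  interpret group "dihedral_group d"
    using group_hom by (rule group_hom.axioms)
  obtain v where v: "v \<in> words d" "b = orbit (dihedral_group d) (\<lambda>g. g) v"
    using assms(1) by (auto simp: binary_bracelets_def orbits_def)
  then obtain g where g: "g \<in> carrier (dihedral_group d)" "rotate n u = g v"
    using Suc by (auto simp: orbit_def)
  \<comment> \<open>This group element sends the orbit representative \<open>v\<close> to the next
    rotation.\<close>
  let ?h = "restrict rotate1 (words d) \<otimes>\<^bsub>dihedral_group d\<^esub> g"
  have "?h v = restrict rotate1 (words d) (g v)"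
    by (rule composition_rule[OF v(1) restrict_rotate1_in_dihedral_group g(1)])
  also have "\<dots> = rotate1 (rotate n u)"
    using element_image[OF g(1) v(1) refl] by (simp add: g(2))
  finally have "rotate1 (rotate n u) = ?h v" ..
  then have "rotate1 (rotate n u) \<in> b"
    unfolding v(2) orbit_def using m_closed[OF restrict_rotate1_in_dihedral_group g(1)] by blast
  then show ?case by simp
qed

lemma binary_bracelet_subset_words: "b \<in> binary_bracelets d \<Longrightarrow> b \<subseteq> words d"
  using group_action.element_image[OF group_action_dihedral_group]
  by (force simp: binary_bracelets_def orbits_def orbit_def)

lemma binary_bracelet_nonempty: "b \<in> binary_bracelets d \<Longrightarrow> b \<noteq> {}"
  using group_action.orbit_refl[OF group_action_dihedral_group]
  by (force simp: binary_bracelets_def orbits_def)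

lemma count_list_True_eq_0_iff: "count_list w True = 0 \<longleftrightarrow> w = replicate (length w) False"
  by (induction w) auto

text \<open>Split at the first letter 1: the prefix has none, hence is a block of zeros.\<close>

lemma count_list_True_eq_Suc:
  assumes "count_list w True = Suc k"
  obtains i v where "w = replicate i False @ True # v" "count_list v True = k"
  using count_list_Suc_split_first[OF assms]
  by (metis count_list_0_iff count_list_True_eq_0_iff)

lemma bracelet_of_weight_2_gap_word:
  assumes "b \<in> bracelets_of_weight 2 d"
  obtains m n where "m \<le> n" "m + n + 2 = d" "gap_word m n \<in> b"
proof -
  have b: "b \<in> binary_bracelets d" "\<And>u. u \<in> b \<Longrightarrow> count_list u True = Suc (Suc 0)"
    using assms by (auto simp: bracelets_of_weight_def)
  obtain w where w: "w \<in> b" using binary_bracelet_nonempty[OF b(1)] by blast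
  obtain i v where v: "w = replicate i False @ True # v" "count_list v True = Suc 0"
    using count_list_True_eq_Suc[OF b(2)[OF w]] by blast
  obtain j x where x: "v = replicate j False @ True # x" "count_list x True = 0"
    using count_list_True_eq_Suc[OF v(2)] by blast
  \<comment> \<open>Cyclically, the zeros after the second 1 and those before the first 1 form a
    single gap.\<close>
  define k where "k = length x + i"
  have "w = replicate i False @ True # replicate j False @ True # replicate (length x) False"
    using v(1) x count_list_True_eq_0_iff by metis
  then have "rotate i w = gap_word j k"
    using rotate_append[of "replicate i False"
        "True # replicate j False @ True # replicate (length x) False"]
    by (simp add: gap_word_def k_def replicate_add)
  then have jk: "gap_word j k \<in> b" using binary_bracelet_rotate[OF b(1) w] by metis
  \<comment> \<open>Moving the first 1 and its \<open>j\<close> zeros to the end swaps the two gaps,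
    so the smaller one may come first.\<close>
  have "rotate (Suc j) (gap_word j k) = gap_word k j"
    using rotate_append[of "True # replicate j False" "True # replicate k False"]
    by (simp add: gap_word_def)
  then have kj: "gap_word k j \<in> b" using binary_bracelet_rotate[OF b(1) jk] by metis
  have "j + k + 2 = d"
    using binary_bracelet_subset_words[OF b(1)] jk by (auto simp: words_def gap_word_def)
  then show thesis
    using that[of j k] that[of k j] jk kj by (cases "j \<le> k") auto
qed

theorem proposition4p10:
  fixes d :: nat
  assumes "d \<ge> 1"
  shows "inj_on bracelet_trace (bracelets_of_weight 2 d) \<and>
         gpoly.independent (bracelet_trace ` bracelets_of_weight 2 d)"
proof -
  have "\<exists>m n. m \<le> n \<and> m + n + 2 = d \<and> gap_word m n \<in> b" if "b \<in> bracelets_of_weight 2 d" for b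
    using bracelet_of_weight_2_gap_word[OF that] by metis
  \<comment> \<open>Choose the gaps of each bracelet; \<open>gap_monomial (m b) (n b)\<close> will
    be its separating monomial.\<close>
  then obtain m n where mn:
    "\<And>b. b \<in> bracelets_of_weight 2 d \<Longrightarrow> m b \<le> n b \<and> m b + n b + 2 = d \<and> gap_word (m b) (n b) \<in> b"
    by metis
  show ?thesis
  proof (rule inj_on_and_independent_if_separating_monomials)
    fix b c
    assume bc: "b \<in> bracelets_of_weight 2 d" "c \<in> bracelets_of_weight 2 d"
    then have brac: "b \<in> binary_bracelets d" "c \<in> binary_bracelets d"
      by (simp_all add: bracelets_of_weight_def)
    have "bracelet_trace b = word_trace (gap_word (m b) (n b))"
      using bracelet_trace_eq brac(1) mn[OF bc(1)] by blast
    moreover have "m b + n b = m c + n c"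
      using mn[OF bc(1)] mn[OF bc(2)] by linarith
    ultimately have
      "Poly_Mapping.lookup (bracelet_trace b) (gap_monomial (m c) (n c)) \<noteq> 0 \<longleftrightarrow> m b = m c"
      using lookup_word_trace_gap_word_eq_0_iff mn[OF bc(1)] mn[OF bc(2)] by simp
    also have "\<dots> \<longleftrightarrow> b = c"
    proof
      \<comment> \<open>The common length makes the second gaps agree too, so the two orbits share a
        gap word and coincide.\<close>
      assume "m b = m c"
      then have "gap_word (m b) (n b) \<in> b \<inter> c"
        using mn[OF bc(1)] mn[OF bc(2)] \<open>m b + n b = m c + n c\<close> by simp
      then show "b = c"
        using group_action.disjoint_union[OF group_action_dihedral_group] brac
        by (fastforce simp: binary_bracelets_def)
    qed simp
    finally show "Poly_Mapping.lookup (bracelet_trace b) (gap_monomial (m c) (n c)) \<noteq> 0 \<longleftrightarrow> b = c" .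
  qed
qed

end
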